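(* For all integers $m\ge 2$ and $\alpha\ge 2$, $$T_m^\alpha - m = T_\alpha^m - \alpha.$$
   Context: For an integer $k\ge 2$ let $\psi_k(n) = n + (k-1)(n-1)B_{n-1,k-1}$, where $B_{a,b}=\frac{(a+b)!}{a!\,b!}$, for positive integers $n$; equivalently $\psi_k$ is the polynomial of degree $k$ in $n$ given by $\psi_k(n) = n + \frac{n-1}{(k-2)!}\prod_{j=0}^{k-2}(n+j)$. For $m\ge 2$, the coefficients $c_{mk}$ ($2\le k\le m$) are the unique rational numbers defined by the polynomial identity $n^m = \sum_{k=2}^m c_{mk}\psi_k(n)$. For integers $m\ge 2$ and $\alpha\ge 1$, $T_m^\alpha := \sum_{k=2}^m c_{mk}k^\alpha$ (the superscript in $T_m^\alpha$ is an index, not a power). *)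

theory Defs
  imports "HOL-Computational_Algebra.Polynomial"
begin

definition B :: "nat \<Rightarrow> nat \<Rightarrow> rat" where
  "B a b = fact (a + b) / (fact a * fact b)"

text \<open>
  Meant for k at least 2. Its values n + (k - 1) (n - 1) B (n - 1) (k - 1) at positive
  integers n are the content of \<open>poly_psi\<close> below.
\<close>

definition psi :: "nat \<Rightarrow> rat poly" where
  "psi k = [:0, 1:] + smult (1 / fact (k - 2)) ([:-1, 1:] * (\<Prod>j\<in>{0..k-2}. [:of_nat j, 1:]))"

lemma poly_psi:
  assumes "k \<ge> 2" and "n \<ge> 1"
  shows "poly (psi k) (of_nat n) =
    of_nat n + (of_nat k - 1) * (of_nat n - 1) * B (n - 1) (k - 1)"
proof -
  obtain i where k: "k = i + 2"
    using assms(1) by (metis add.commute le_Suc_ex)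
  obtain l where n: "n = Suc l"
    using assms(2) by (cases n) auto
  have prod: "(\<Prod>j\<in>{0..i}. (of_nat j + of_nat (Suc l) :: rat)) * fact l = fact (l + i + 1)"
  proof (induction i)
    case (Suc i)
    have "(\<Prod>j\<in>{0..Suc i}. (of_nat j + of_nat (Suc l) :: rat)) * fact l
        = (of_nat (Suc i) + of_nat (Suc l)) * ((\<Prod>j\<in>{0..i}. (of_nat j + of_nat (Suc l))) * fact l)"
      by (simp only: prod.atLeast0_atMost_Suc ac_simps)
    also have "\<dots> = fact (l + Suc i + 1)"
      unfolding Suc.IH by (simp add: algebra_simps)
    finally show ?case .
  qed (simp add: algebra_simps)
  have f: "(fact (i + 1) :: rat) = of_nat (i + 1) * fact i"
    by simp
  have "poly (psi k) (of_nat n)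
      = of_nat n + (of_nat n - 1) * ((\<Prod>j\<in>{0..i}. (of_nat j + of_nat (Suc l) :: rat)) / fact i)"
  proof -
    have "poly [:-1, 1:] (of_nat n) = (of_nat n - 1 :: rat)" "k - 2 = i"
      using k by simp_all
    moreover have "poly (\<Prod>j\<in>{0..i}. [:of_nat j, 1:]) (of_nat n)
        = (\<Prod>j\<in>{0..i}. (of_nat j + of_nat (Suc l) :: rat))"
      by (simp add: poly_prod n)
    ultimately show ?thesis
      unfolding psi_def poly_add poly_smult poly_mult by simp
  qed
  also have "(\<Prod>j\<in>{0..i}. (of_nat j + of_nat (Suc l) :: rat)) / fact i
      = (of_nat k - 1) * B (n - 1) (k - 1)"
  proof -
    have "of_nat k - 1 = (of_nat (i + 1) :: rat)" "n - 1 = l" "k - 1 = i + 1"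
      using k n by simp_all
    moreover have "(of_nat (i + 1) :: rat) \<noteq> 0"
      by (simp del: of_nat_Suc of_nat_add)
    moreover have "B l (i + 1) = (\<Prod>j\<in>{0..i}. (of_nat j + of_nat (Suc l))) / fact (i + 1)"
      unfolding B_def add.assoc [symmetric] prod [symmetric]
      by (simp del: fact_Suc of_nat_Suc add: mult.commute [of _ "fact l"])
    ultimately show ?thesis
      unfolding f by (simp only: times_divide_eq_right nonzero_mult_divide_mult_cancel_left not_False_eq_True)
  qed
  finally show ?thesis
    by (simp only: ac_simps)
qed

text \<open>
  The coefficients are normalised to vanish outside the range of the summation, so that
  they are determined uniquely as a function of k (\<open>is_coeffs_ex1\<close> below).
\<close>

definition is_coeffs :: "nat \<Rightarrow> (nat \<Rightarrow> rat) \<Rightarrow> bool" where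
  "is_coeffs m d \<longleftrightarrow>
    (\<forall>k. k \<notin> {2..m} \<longrightarrow> d k = 0) \<and> monom 1 m = (\<Sum>k=2..m. smult (d k) (psi k))"

definition psi_coeff :: "nat \<Rightarrow> nat \<Rightarrow> rat" where
  "psi_coeff m = (THE d. is_coeffs m d)"

definition T :: "nat \<Rightarrow> nat \<Rightarrow> rat" where
  "T m \<alpha> = (\<Sum>k=2..m. psi_coeff m k * of_nat k ^ \<alpha>)"

lemma psi_prod_degree:
  "degree (\<Prod>j\<in>{0..i}. [:of_nat j, 1 :: rat:]) = Suc i"
  by (subst degree_prod_eq_sum_degree) auto

lemma psi_prod_lead_coeff:
  "lead_coeff (\<Prod>j\<in>{0..i}. [:of_nat j, 1 :: rat:]) = 1"
  by (simp add: lead_coeff_prod)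

lemma psi_degree:
  assumes "k \<ge> 2"
  shows "degree (psi k) = k" and "coeff (psi k) k \<noteq> 0"
proof -
  let ?q = "[:-1, 1:] * (\<Prod>j\<in>{0..k-2}. [:of_nat j, 1 :: rat:])"
  have q: "degree ?q = k"
    using assms psi_prod_degree [of "k - 2"] by (subst degree_mult_eq) auto
  have l: "coeff ?q k = 1"
    using lead_coeff_mult [of "[:-1, 1:]" "\<Prod>j\<in>{0..k-2}. [:of_nat j, 1 :: rat:]"]
    unfolding q psi_prod_lead_coeff by simp
  have "degree (smult (1 / fact (k - 2)) ?q) = k"
    using q by simp
  then show d: "degree (psi k) = k"
    unfolding psi_def using assms by (subst degree_add_eq_right) auto
  have "coeff [:0, 1 :: rat:] k = 0"
    using assms by (intro coeff_eq_0) simp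
  then show "coeff (psi k) k \<noteq> 0"
    unfolding psi_def coeff_add coeff_smult l by simp
qed

lemma psi_low_coeffs: "coeff (psi k) 0 = 0" "coeff (psi k) (Suc 0) = 0"
proof -
  have c0: "(\<Prod>j\<in>{0..i}. [:of_nat j, 1 :: rat:]) = [:0, 1:] * (\<Prod>j\<in>{1..i}. [:of_nat j, 1:])" for i
    by (simp add: prod.atLeast_Suc_atMost)
  have c1: "coeff (\<Prod>j\<in>{1..i}. [:of_nat j, 1 :: rat:]) 0 = fact i" for i
    by (induction i) (simp_all add: prod.nat_ivl_Suc' coeff_mult)
  show "coeff (psi k) 0 = 0" "coeff (psi k) (Suc 0) = 0"
    unfolding psi_def c0 using c1 [of "k - 2"] by simp_all
qed

lemma psi_span:
  assumes "degree p \<le> m" "coeff p 0 = 0" "coeff p (Suc 0) = 0"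
  shows "\<exists>d. (\<forall>k. k \<notin> {2..m} \<longrightarrow> d k = 0) \<and> p = (\<Sum>k=2..m. smult (d k) (psi k))"
  using assms
proof (induction m arbitrary: p)
  case 0
  then have "p = 0"
    by (metis le_zero_eq pCons_0_0 degree_eq_zeroE coeff_pCons_0)
  then show ?case
    by (intro exI [of _ "\<lambda>_. 0"]) simp
next
  case (Suc m)
  show ?case
  proof (cases "m = 0")
    case True
    have "p = 0"
    proof (rule poly_eqI)
      fix n
      show "coeff p n = coeff 0 n"
        using Suc.prems True coeff_eq_0 [of p n] by (cases n; cases "n - 1") auto
    qed
    then show ?thesis
      by (intro exI [of _ "\<lambda>_. 0"]) simp
  next
    case False
    then have m: "Suc m \<ge> 2"
      by simp
    define a where "a = coeff p (Suc m) / coeff (psi (Suc m)) (Suc m)"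
    define q where "q = p - smult a (psi (Suc m))"
    have "degree q \<le> m"
    proof (rule degree_le, intro allI impI)
      fix i assume i: "m < i"
      show "coeff q i = 0"
      proof (cases "i = Suc m")
        case True
        then show ?thesis
          using psi_degree(2) [OF m] by (simp add: q_def a_def)
      next
        case False
        then show ?thesis
          using i psi_degree(1) [OF m] Suc.prems(1) by (simp add: q_def coeff_eq_0)
      qed
    qed
    moreover have "coeff q 0 = 0" "coeff q (Suc 0) = 0"
      using Suc.prems by (simp_all add: q_def psi_low_coeffs)
    ultimately obtain d where d: "\<And>k. k \<notin> {2..m} \<Longrightarrow> d k = 0"
        "q = (\<Sum>k=2..m. smult (d k) (psi k))"
      using Suc.IH by blast
    have "p = q + smult a (psi (Suc m))"
      by (simp add: q_def)
    also have "\<dots> = (\<Sum>k=2..Suc m. smult ((d(Suc m := a)) k) (psi k))"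
      using m by (simp add: d(2))
    finally show ?thesis
      using d(1) m by (intro exI [of _ "d(Suc m := a)"]) auto
  qed
qed

lemma psi_independent:
  assumes "(\<Sum>k=2..m. smult (d k) (psi k)) = 0" "k \<in> {2..m}"
  shows "d k = 0"
  using assms
proof (induction m)
  case 0
  then show ?case by simp
next
  case (Suc m)
  then have m: "Suc m \<ge> 2"
    by simp
  have s: "(\<Sum>k=2..m. smult (d k) (psi k)) + smult (d (Suc m)) (psi (Suc m)) = 0"
    using Suc.prems(1) m by simp
  have "coeff (\<Sum>k=2..m. smult (d k) (psi k)) (Suc m) = 0"
    by (auto simp: coeff_sum psi_degree(1) intro!: sum.neutral coeff_eq_0)
  then have "d (Suc m) = 0"
    using arg_cong [OF s, of "\<lambda>p. coeff p (Suc m)"] psi_degree(2) [OF m] by simp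
  then show ?case
    using s Suc.IH Suc.prems(2) by (cases "k = Suc m") auto
qed

lemma is_coeffs_ex1:
  assumes "m \<ge> 2"
  shows "\<exists>!d. is_coeffs m d"
proof (rule ex_ex1I)
  show "\<exists>d. is_coeffs m d"
    unfolding is_coeffs_def using assms
    by (intro psi_span) (auto simp: degree_monom_eq)
next
  fix d e
  assume d: "is_coeffs m d" and e: "is_coeffs m e"
  have "(\<Sum>k=2..m. smult (d k - e k) (psi k)) = 0"
    using d e by (simp add: is_coeffs_def smult_diff_left sum_subtractf)
  then have "d k = e k" if "k \<in> {2..m}" for k
    using psi_independent [of "\<lambda>k. d k - e k" m k] that by simp
  then show "d = e"
    using d e unfolding is_coeffs_def by (metis ext)
qed

lemma is_coeffs_psi_coeff: "m \<ge> 2 \<Longrightarrow> is_coeffs m (psi_coeff m)"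
  unfolding psi_coeff_def using theI' [OF is_coeffs_ex1] .

end

theory Submission
  imports Defs
begin

text \<open>
  The polynomial \<open>psi k\<close> exceeds the identity by a kernel
  \<open>kernel k n = (k - 1) (n - 1) B (n - 1) (k - 1)\<close> that is symmetric in \<open>k\<close> and \<open>n\<close>.
  Evaluating the expansion of the power \<open>n ^ m\<close> at 1, where the kernel vanishes, shows
  that its coefficients sum to 1, so \<open>n ^ m - n\<close> is the combination of the \<open>kernel k n\<close> with
  the coefficients of \<open>m\<close> (\<open>sum_psi_coeff_kernel\<close>). Expanding \<open>k ^ \<alpha> - k\<close> in this way
  turns \<open>T m \<alpha> - T m 1\<close> into a double sum of \<open>psi_coeff m k * psi_coeff \<alpha> j * kernel j k\<close>,
  which by the symmetry of the kernel is unchanged when \<open>m\<close> and \<open>\<alpha>\<close> are exchanged.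

  It remains to see that \<open>T m 1 = m\<close> (\<open>T_one\<close>). This is the derivative at 1 of the defining
  expansion: the left side contributes \<open>m\<close>, and \<open>psi k\<close> has derivative \<open>k\<close> there.
\<close>

lemma power_eq_sum_psi:
  assumes "m \<ge> 2"
  shows "monom 1 m = (\<Sum>k=2..m. smult (psi_coeff m k) (psi k))"
  using is_coeffs_psi_coeff [OF assms] unfolding is_coeffs_def by blast

lemma poly_psi_1: "poly (psi k) 1 = 1"
  by (simp add: psi_def)

text \<open>
  The second summand of \<open>psi k\<close> has the factor \<open>n - 1\<close>, so only the derivative of that
  factor survives at 1; it is multiplied by \<open>fact (k - 1) / fact (k - 2) = k - 1\<close>.
\<close>

lemma poly_pderiv_psi_1:
  assumes "k \<ge> 2"
  shows "poly (pderiv (psi k)) 1 = of_nat k"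
proof -
  obtain i where k: "k = i + 2"
    using assms by (metis add.commute le_Suc_ex)
  have "(\<Prod>j\<in>{0..i}. (of_nat j + 1 :: rat)) = fact (Suc i)"
    by (induction i) (simp_all add: algebra_simps)
  then have "poly (\<Prod>j\<in>{0..i}. [:of_nat j, 1 :: rat:]) 1 = (of_nat i + 1) * fact i"
    by (simp add: poly_prod algebra_simps)
  then show ?thesis
    by (simp add: psi_def k pderiv_add pderiv_smult pderiv_mult pderiv_pCons del: mult_pCons_left)
qed

definition kernel :: "nat \<Rightarrow> nat \<Rightarrow> rat" where
  "kernel k n = (of_nat k - 1) * (of_nat n - 1) * B (n - 1) (k - 1)"

lemma kernel_commute: "kernel k n = kernel n k"
  by (simp add: kernel_def B_def ac_simps)

lemma poly_psi_kernel:
  assumes "k \<ge> 2" "n \<ge> 1"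
  shows "poly (psi k) (of_nat n) = of_nat n + kernel k n"
  unfolding kernel_def by (rule poly_psi [OF assms])

lemma sum_psi_coeff:
  assumes "m \<ge> 2"
  shows "(\<Sum>k=2..m. psi_coeff m k) = 1"
  using arg_cong [OF power_eq_sum_psi [OF assms], of "\<lambda>p. poly p 1"]
  by (simp add: poly_sum poly_monom poly_psi_1)

lemma sum_psi_coeff_kernel:
  assumes "m \<ge> 2" "n \<ge> 1"
  shows "(\<Sum>k=2..m. psi_coeff m k * kernel k n) = of_nat n ^ m - of_nat n"
proof -
  have "of_nat n ^ m = (\<Sum>k=2..m. psi_coeff m k * poly (psi k) (of_nat n))"
    using arg_cong [OF power_eq_sum_psi [OF assms(1)], of "\<lambda>p. poly p (of_nat n)"]
    by (simp add: poly_sum poly_monom)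
  also have "\<dots> = (\<Sum>k=2..m. psi_coeff m k * of_nat n + psi_coeff m k * kernel k n)"
    by (intro sum.cong refl) (use assms(2) in \<open>simp add: poly_psi_kernel distrib_left\<close>)
  also have "\<dots> = of_nat n + (\<Sum>k=2..m. psi_coeff m k * kernel k n)"
    by (simp add: sum.distrib sum_psi_coeff [OF assms(1)] flip: sum_distrib_right)
  finally show ?thesis
    by simp
qed

lemma T_one:
  assumes "m \<ge> 2"
  shows "T m 1 = of_nat m"
proof -
  have "of_nat m = poly (pderiv (monom 1 m)) (1 :: rat)"
    by (simp add: pderiv_monom poly_monom)
  also have "\<dots> = (\<Sum>k=2..m. psi_coeff m k * poly (pderiv (psi k)) 1)"
    unfolding power_eq_sum_psi [OF assms]
    by (simp add: higher_pderiv_sum [of 1, simplified] pderiv_smult poly_sum)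
  also have "\<dots> = T m 1"
    by (simp add: T_def poly_pderiv_psi_1)
  finally show ?thesis
    by simp
qed

lemma T_diff_eq_double_sum:
  assumes "m \<ge> 2" "\<alpha> \<ge> 2"
  shows "T m \<alpha> - of_nat m
    = (\<Sum>k=2..m. \<Sum>j=2..\<alpha>. psi_coeff m k * psi_coeff \<alpha> j * kernel j k)"
proof -
  have "T m \<alpha> - of_nat m = (\<Sum>k=2..m. psi_coeff m k * (of_nat k ^ \<alpha> - of_nat k))"
    using T_one [OF assms(1)] by (simp add: T_def right_diff_distrib sum_subtractf)
  also have "\<dots> = (\<Sum>k=2..m. psi_coeff m k * (\<Sum>j=2..\<alpha>. psi_coeff \<alpha> j * kernel j k))"
    by (intro sum.cong refl) (simp add: sum_psi_coeff_kernel [OF assms(2)])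
  finally show ?thesis
    by (simp add: sum_distrib_left mult.assoc)
qed

theorem mainTheorem5:
  fixes m \<alpha> :: nat
  assumes "m \<ge> 2" and "\<alpha> \<ge> 2"
  shows "T m \<alpha> - of_nat m = T \<alpha> m - of_nat \<alpha>"
proof -
  have "T m \<alpha> - of_nat m
      = (\<Sum>j=2..\<alpha>. \<Sum>k=2..m. psi_coeff m k * psi_coeff \<alpha> j * kernel j k)"
    unfolding T_diff_eq_double_sum [OF assms] by (rule sum.swap)
  also have "\<dots> = (\<Sum>j=2..\<alpha>. \<Sum>k=2..m. psi_coeff \<alpha> j * psi_coeff m k * kernel k j)"
    by (intro sum.cong refl) (simp add: kernel_commute mult.commute)
  also have "\<dots> = T \<alpha> m - of_nat \<alpha>"
    by (rule T_diff_eq_double_sum [OF assms(2,1), symmetric])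
  finally show ?thesis .
qed

end
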